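(* Let $\tau=123$. For all $k\ge 2$, \[ F_\tau(x,y;k)=\frac{1}{1-kx-\sum_{j=3}^{k}(-x)^j\binom{k}{j}(1-y)^{\lfloor j/2\rfloor}U_{j-3}(y)}, \] where the polynomials $U_n(y)$ are defined by $U_0(y)=U_1(y)=1$, $U_{2n}(y)=(1-y)U_{2n-1}(y)-U_{2n-2}(y)$ and $U_{2n+1}(y)=U_{2n}(y)-U_{2n-1}(y)$ for $n\ge1$. Furthermore, \[ \sum_{n\ge0}U_n(y)z^n=\frac{1+z+z^2}{1+(1+y)z^2+z^4}. \]
   Context: $[k]^n$ is the set of words of length $n$ over $\{1,\dots,k\}$. An occurrence of the subword pattern $123$ in $\sigma=\sigma_1\cdots\sigma_n$ is an index $i$ with $\sigma_i<\sigma_{i+1}<\sigma_{i+2}$. $\sigma(123)$ is the number of occurrences, and $F_{123}(x,y;k)=\sum_{n\ge0}\sum_{\sigma\in[k]^n}x^ny^{\sigma(123)}$. *)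

theory Defs
  imports "HOL-Computational_Algebra.Computational_Algebra"
begin

definition words :: "nat \<Rightarrow> nat \<Rightarrow> nat list set" where
  "words k n = {w. length w = n \<and> set w \<subseteq> {1..k}}"

definition occ123 :: "nat list \<Rightarrow> nat" where
  "occ123 w = card {i. i + 2 < length w \<and> w ! i < w ! (i + 1) \<and> w ! (i + 1) < w ! (i + 2)}"

text \<open>
  Generating functions live in \<open>\<int>[y][[x]]\<close>: the coefficients are polynomials
  in the indeterminate \<open>y\<close>, and \<open>x\<close> is \<^const>\<open>fps_X\<close>.
\<close>

abbreviation Y :: "int poly" where
  "Y \<equiv> [:0, 1:]"

definition F123 :: "nat \<Rightarrow> int poly fps" where
  "F123 k = Abs_fps (\<lambda>n. \<Sum>w\<in>words k n. Y ^ occ123 w)"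

fun U :: "nat \<Rightarrow> int poly" where
  "U 0 = 1"
| "U (Suc 0) = 1"
| "U (Suc (Suc m)) = (if even m then (1 - Y) * U (Suc m) - U m else U (Suc m) - U m)"

lemma U_1: "U 1 = 1"
  by simp

lemma U_even: "n \<ge> 1 \<Longrightarrow> U (2 * n) = (1 - Y) * U (2 * n - 1) - U (2 * n - 2)"
  by (cases n) simp_all

lemma U_odd: "n \<ge> 1 \<Longrightarrow> U (2 * n + 1) = U (2 * n) - U (2 * n - 1)"
  by (cases n) simp_all

text \<open>
  Division of formal power series needs coefficients with an inverse operation, so quotients
  are formed after the coefficientwise embedding of \<open>\<int>[y][[x]]\<close> into \<open>\<rat>(y)[[x]]\<close>.
\<close>

definition fps_to_fract :: "'a::idom fps \<Rightarrow> 'a fract fps" where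
  "fps_to_fract f = Abs_fps (\<lambda>n. to_fract (f $ n))"

lemma fps_to_fract_eq_iff: "fps_to_fract f = fps_to_fract g \<longleftrightarrow> f = g"
  by (simp add: fps_to_fract_def fps_eq_iff)

end

theory Submission
  imports Defs
begin

text \<open>
  Put \<open>t = y - 1\<close>. For a word \<open>w\<close> whose first \<open>j\<close> letters increase strictly, weigh \<open>w\<close> by the
  occurrences of 123 in the suffix obtained by dropping the first \<open>i\<close> letters. Dropping one more
  letter costs a factor \<open>y = 1 + t\<close> exactly when an occurrence starts at position \<open>i\<close>; for
  \<open>i < j \<le> i + 3\<close> that happens exactly when the increasing prefix has length at least \<open>i + 3\<close>.
  Iterating this from \<open>i = 0\<close> expresses the sum over all words through the sums with \<open>i = j\<close>, which
  are \<open>k choose j\<close> times the sum over words of length \<open>n - j\<close>. The coefficients that arise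
  are the weights of clusters of overlapping occurrences, with the recurrence
  \<open>c (j + 2) = t (c j + c (j + 1))\<close>, and the process stops since no strictly increasing word over
  \<open>k\<close> letters is longer than \<open>k\<close>.
\<close>

section \<open>Words with an increasing prefix\<close>

text \<open>The bound \<open>j \<le> n\<close> keeps the indexing in range and makes the sums vanish
  when the prefix does not fit.\<close>

definition inc_words :: "nat \<Rightarrow> nat \<Rightarrow> nat \<Rightarrow> nat list set" where
  "inc_words k n j = {w \<in> words k n. j \<le> n \<and> (\<forall>i. Suc i < j \<longrightarrow> w ! i < w ! Suc i)}"

definition inc_sum :: "nat \<Rightarrow> nat \<Rightarrow> nat \<Rightarrow> nat \<Rightarrow> int poly" where
  "inc_sum k n j i = (\<Sum>w\<in>inc_words k n j. Y ^ occ123 (drop i w))"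

lemma finite_words: "finite (words k n)"
  using finite_lists_length_eq[of "{1..k}" n] by (simp add: words_def conj_commute)

lemma finite_inc_words: "finite (inc_words k n j)"
  using finite_words by (simp add: inc_words_def)

lemma occ123_Cons:
  "occ123 (a # w) =
     occ123 w + (if 2 \<le> length w \<and> a < w ! 0 \<and> w ! 0 < w ! 1 then 1 else 0)"
proof -
  let ?P = "\<lambda>v i. i + 2 < length v \<and> v ! i < v ! (i + 1) \<and> v ! (i + 1) < v ! (i + 2)"
  have fin: "finite {i. ?P v i}" for v :: "nat list"
    by (rule finite_subset[of _ "{..<length v}"]) auto
  have "{i. ?P (a # w) i} = Suc ` {i. ?P w i} \<union> {i. i = 0 \<and> ?P (a # w) 0}"
  proof (intro set_eqI)
    fix i
    show "i \<in> {i. ?P (a # w) i} \<longleftrightarrow>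
        i \<in> Suc ` {i. ?P w i} \<union> {i. i = 0 \<and> ?P (a # w) 0}"
      by (cases i) auto
  qed
  moreover have "card (Suc ` {i. ?P w i} \<union> {i. i = 0 \<and> ?P (a # w) 0}) =
      card (Suc ` {i. ?P w i}) + card {i::nat. i = 0 \<and> ?P (a # w) 0}"
    by (rule card_Un_disjoint) (use fin in auto)
  moreover have "card (Suc ` {i. ?P w i}) = card {i. ?P w i}"
    by (rule card_image) simp
  moreover have "card {i::nat. i = 0 \<and> ?P (a # w) 0} =
      (if 2 \<le> length w \<and> a < w ! 0 \<and> w ! 0 < w ! 1 then 1 else 0)"
    by (auto simp: numeral_2_eq_2 Suc_le_eq)
  ultimately show ?thesis
    unfolding occ123_def by presburger
qed

lemma occ123_drop:
  assumes "i < length w"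
  shows "occ123 (drop i w) = occ123 (drop (Suc i) w) +
    (if i + 2 < length w \<and> w ! i < w ! (i + 1) \<and> w ! (i + 1) < w ! (i + 2) then 1 else 0)"
  using assms by (auto simp: Cons_nth_drop_Suc[symmetric] occ123_Cons)

lemma inc_sum_drop_step:
  assumes "i < j" "j \<le> i + 3"
  shows "inc_sum k n j i = inc_sum k n j (Suc i) + (Y - 1) * inc_sum k n (i + 3) (Suc i)"
proof -
  let ?Q = "\<lambda>w. i + 2 < n \<and> w ! i < w ! (i + 1) \<and> w ! (i + 1) < w ! (i + 2)"
  have eq: "{w \<in> inc_words k n j. ?Q w} = inc_words k n (i + 3)"
  proof (intro equalityI subsetI)
    fix w assume w: "w \<in> {w \<in> inc_words k n j. ?Q w}"
    have "w ! l < w ! Suc l" if "Suc l < i + 3" for l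
    proof -
      \<comment> \<open>Since \<open>i < j\<close>, the prefix supplies every ascent before position
        \<open>i\<close>; the occurrence supplies those at \<open>i\<close> and
        \<open>i + 1\<close>.\<close>
      have "Suc l < j \<or> l = i \<or> l = i + 1" using that assms by linarith
      thus ?thesis using w by (elim disjE) (auto simp: inc_words_def)
    qed
    thus "w \<in> inc_words k n (i + 3)" using w by (auto simp: inc_words_def)
  qed (use assms in \<open>auto simp: inc_words_def\<close>)
  have "inc_sum k n j i =
      (\<Sum>w\<in>inc_words k n j. Y ^ occ123 (drop (Suc i) w)
         + (if ?Q w then (Y - 1) * Y ^ occ123 (drop (Suc i) w) else 0))"
    unfolding inc_sum_def
  proof (rule sum.cong)
    fix w assume "w \<in> inc_words k n j"
    hence "length w = n" "i < n" using assms by (auto simp: inc_words_def words_def)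
    thus "Y ^ occ123 (drop i w) = Y ^ occ123 (drop (Suc i) w)
         + (if ?Q w then (Y - 1) * Y ^ occ123 (drop (Suc i) w) else 0)"
      by (simp add: occ123_drop[of i w] left_diff_distrib)
  qed simp
  also have "\<dots> = inc_sum k n j (Suc i)
      + (\<Sum>w\<in>{w \<in> inc_words k n j. ?Q w}. (Y - 1) * Y ^ occ123 (drop (Suc i) w))"
    by (simp only: inc_sum_def sum.distrib sum.inter_filter[OF finite_inc_words])
  finally show ?thesis
    by (simp only: eq) (simp only: inc_sum_def sum_distrib_left)
qed

section \<open>Splitting off the prefix\<close>

text \<open>A strictly increasing list is determined by its set of entries, so these lists
  correspond to the \<open>j\<close>-subsets of \<open>{1..k}\<close>.\<close>

lemma card_strictly_increasing_lists:
  "card {u. length u = j \<and> set u \<subseteq> {1..k} \<and> sorted_wrt (<) u} = k choose j"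
proof -
  have "bij_betw set {u. length u = j \<and> set u \<subseteq> {1..k} \<and> sorted_wrt (<) u}
          {A. A \<subseteq> {1..k} \<and> card A = j}"
  proof (rule bij_betw_byWitness[where f' = sorted_list_of_set])
    show "\<forall>u\<in>{u. length u = j \<and> set u \<subseteq> {1..k} \<and> sorted_wrt (<) u}.
        sorted_list_of_set (set u) = u"
      by (auto simp: strict_sorted_iff sorted_list_of_set.idem_if_sorted_distinct)
    show "\<forall>A\<in>{A. A \<subseteq> {1..k} \<and> card A = j}. set (sorted_list_of_set A) = A"
      by (auto dest: finite_subset)
    show "set ` {u. length u = j \<and> set u \<subseteq> {1..k} \<and> sorted_wrt (<) u}
        \<subseteq> {A. A \<subseteq> {1..k} \<and> card A = j}"
      by (auto simp: strict_sorted_iff distinct_card)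
    show "sorted_list_of_set ` {A. A \<subseteq> {1..k} \<and> card A = j}
        \<subseteq> {u. length u = j \<and> set u \<subseteq> {1..k} \<and> sorted_wrt (<) u}"
    proof (rule image_subsetI)
      fix A assume "A \<in> {A. A \<subseteq> {1..k} \<and> card A = j}"
      moreover from this have "finite A" by (auto dest: finite_subset)
      ultimately show "sorted_list_of_set A
          \<in> {u. length u = j \<and> set u \<subseteq> {1..k} \<and> sorted_wrt (<) u}"
        by simp
    qed
  qed
  thus ?thesis
    using n_subsets[of "{1..k}" j] by (simp add: bij_betw_same_card)
qed

lemma inc_words_iff:
  "w \<in> inc_words k n j \<longleftrightarrow>
     w \<in> words k n \<and> j \<le> n \<and> sorted_wrt (<) (take j w)"
  by (auto simp: inc_words_def words_def sorted_wrt_iff_nth_Suc_transp)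

text \<open>Pigeonhole: the prefix would consist of \<open>j\<close> distinct letters out of
  \<open>k\<close>.\<close>

lemma inc_words_empty:
  assumes "k < j"
  shows "inc_words k n j = {}"
proof -
  have False if "w \<in> inc_words k n j" for w
  proof -
    have w: "set w \<subseteq> {1..k}" "j \<le> length w" "distinct (take j w)"
      using that by (auto simp: inc_words_iff words_def strict_sorted_iff)
    have "card (set (take j w)) \<le> card {1..k}"
      by (rule card_mono) (use w set_take_subset[of j w] in auto)
    thus False using w assms by (simp add: distinct_card)
  qed
  thus ?thesis by blast
qed

lemma F123_nth: "F123 k $ n = (\<Sum>w\<in>words k n. Y ^ occ123 w)"
  by (simp add: F123_def)

text \<open>Once the whole prefix is dropped, the weight depends on the remaining suffix only, and
  prefix and suffix are chosen independently.\<close>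

lemma inc_sum_diagonal:
  "inc_sum k n j j = (if j \<le> n then of_nat (k choose j) * F123 k $ (n - j) else 0)"
proof (cases "j \<le> n")
  case True
  let ?I = "{u. length u = j \<and> set u \<subseteq> {1..k} \<and> sorted_wrt (<) u}"
  have "inc_sum k n j j = (\<Sum>(u, v)\<in>?I \<times> words k (n - j). Y ^ occ123 v)"
    unfolding inc_sum_def
  proof (rule sum.reindex_bij_witness[where i = "\<lambda>(u, v). u @ v"
        and j = "\<lambda>w. (take j w, drop j w)"])
    fix w assume "w \<in> inc_words k n j"
    thus "(take j w, drop j w) \<in> ?I \<times> words k (n - j)"
      using True set_take_subset[of j w] set_drop_subset[of j w]
      by (auto simp: inc_words_iff words_def)
  qed (use True in \<open>auto simp: inc_words_iff words_def\<close>)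
  also have "\<dots> = of_nat (card ?I) * F123 k $ (n - j)"
    by (simp add: sum.cartesian_product[symmetric] F123_nth)
  finally show ?thesis
    using True by (simp only: card_strictly_increasing_lists if_True)
next
  case False
  thus ?thesis by (simp add: inc_sum_def inc_words_def)
qed

section \<open>Cluster weights\<close>

text \<open>\<open>cluster m\<close> is the weight of the clusters spanning \<open>m + 1\<close> letters.\<close>

fun cluster :: "nat \<Rightarrow> int poly" where
  "cluster 0 = 1"
| "cluster (Suc 0) = 0"
| "cluster (Suc (Suc m)) = (Y - 1) * (cluster m + cluster (Suc m))"

text \<open>\<open>U\<close> is what remains of the weight after removing the sign and the power of
  \<open>1 - Y\<close>. That exponent grows only at every second step, which is why the recurrence
  of \<open>U\<close> alternates with parity.\<close>

lemma cluster_U: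
  "cluster (m + 2) = (- 1) ^ (m + 3) * ((1 - Y) ^ ((m + 3) div 2) * U m)"
proof (induction m rule: induct_nat_012)
  case (ge2 m)
  define s where "s = 1 - Y"
  have "cluster (Suc (Suc m) + 2) = - s * (cluster (m + 2) + cluster (Suc m + 2))"
    by (simp only: add_Suc cluster.simps s_def minus_diff_eq)
  also have "\<dots> = (- 1) ^ (Suc (Suc m) + 3) * (s ^ ((Suc (Suc m) + 3) div 2) * U (Suc (Suc m)))"
  proof (cases "even m")
    case True
    then obtain l where l: "m = 2 * l" by (elim evenE)
    have d: "(m + 3) div 2 = l + 1" "(Suc m + 3) div 2 = l + 2" "(Suc (Suc m) + 3) div 2 = l + 2"
      unfolding l by simp_all
    have u: "U (Suc (Suc m)) = s * U (Suc m) - U m"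
      using True by (simp only: U.simps if_True s_def)
    show ?thesis
      unfolding ge2.IH s_def[symmetric] d u by (simp add: l power_add algebra_simps power2_eq_square del: U.simps)
  next
    case False
    then obtain l where l: "m = 2 * l + 1" by (elim oddE)
    have d: "(m + 3) div 2 = l + 2" "(Suc m + 3) div 2 = l + 2" "(Suc (Suc m) + 3) div 2 = l + 3"
      unfolding l by simp_all
    have u: "U (Suc (Suc m)) = U (Suc m) - U m"
      using False by (simp only: U.simps if_False)
    show ?thesis
      unfolding ge2.IH s_def[symmetric] d u
      by (simp add: l power_add algebra_simps power2_eq_square power3_eq_cube del: U.simps)
  qed
  finally show ?case by (simp only: s_def)
next
  case 0
  have "cluster (0 + 2) = Y - 1" by (simp add: numeral_2_eq_2)
  thus ?case by simp
next
  case 1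
  have "cluster (Suc 0 + 2) = (Y - 1) * (Y - 1)" by (simp add: numeral_2_eq_2)
  thus ?case by (simp add: power2_eq_square algebra_simps)
qed

text \<open>Only two sums off the diagonal survive at each stage, with prefix lengths
  \<open>m + 1\<close> and \<open>m + 2\<close>. Dropping a letter in both creates the same new sum
  with prefix \<open>m + 3\<close>, so their weights add up; this is the recurrence of
  \<open>cluster\<close>.\<close>

lemma inc_sum_unfold:
  "inc_sum k n 1 0 = (\<Sum>j<m. cluster j * inc_sum k n (Suc j) (Suc j))
     + cluster m * inc_sum k n (Suc m) m + cluster (Suc m) * inc_sum k n (Suc (Suc m)) m"
proof (induction m)
  case (Suc m)
  have 1: "inc_sum k n (Suc m) m =
      inc_sum k n (Suc m) (Suc m) + (Y - 1) * inc_sum k n (m + 3) (Suc m)"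
    by (rule inc_sum_drop_step) auto
  have 2: "inc_sum k n (Suc (Suc m)) m =
      inc_sum k n (Suc (Suc m)) (Suc m) + (Y - 1) * inc_sum k n (m + 3) (Suc m)"
    by (rule inc_sum_drop_step) auto
  have 3: "Suc (Suc (Suc m)) = m + 3" by simp
  show ?case
    unfolding Suc.IH 1 2 3 cluster.simps sum.lessThan_Suc by (simp only: algebra_simps)
qed simp

lemma F123_recurrence:
  assumes "n > 0"
  shows "F123 k $ n = (\<Sum>j<k. cluster j *
           (if Suc j \<le> n then of_nat (k choose Suc j) * F123 k $ (n - Suc j) else 0))"
proof -
  have "inc_words k n 1 = words k n"
    using assms by (auto simp: inc_words_def)
  hence "F123 k $ n = inc_sum k n 1 0"
    by (simp add: F123_nth inc_sum_def)
  also have "\<dots> = (\<Sum>j<k. cluster j * inc_sum k n (Suc j) (Suc j))"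
    \<comment> \<open>After \<open>k\<close> stages the two remaining sums have prefixes longer than
      \<open>k\<close>, hence are empty.\<close>
    unfolding inc_sum_unfold[of k n k]
    by (simp add: inc_sum_def[of _ _ _ k] inc_words_empty)
  finally show ?thesis
    by (simp only: inc_sum_diagonal)
qed

section \<open>Generating functions\<close>

text \<open>The recurrence read as a convolution; the 1 on the right is the empty word.\<close>

lemma F123_times_cluster_series:
  "F123 k * (1 - (\<Sum>j<k. fps_const (of_nat (k choose Suc j) * cluster j) * fps_X ^ Suc j)) = 1"
proof (rule fps_ext)
  fix n
  have "(F123 k * (\<Sum>j<k. fps_const (of_nat (k choose Suc j) * cluster j) * fps_X ^ Suc j)) $ n
      = (\<Sum>j<k. (fps_const (of_nat (k choose Suc j) * cluster j) * (F123 k * fps_X ^ Suc j)) $ n)"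
    by (simp only: sum_distrib_left fps_sum_nth mult.left_commute)
  also have "\<dots> = (\<Sum>j<k. cluster j *
      (if Suc j \<le> n then of_nat (k choose Suc j) * F123 k $ (n - Suc j) else 0))"
    by (intro sum.cong refl)
       (simp only: fps_mult_left_const_nth fps_X_power_mult_right_nth, simp add: not_less_eq_eq)
  finally have *: "(F123 k * (1 - (\<Sum>j<k. fps_const (of_nat (k choose Suc j) * cluster j)
        * fps_X ^ Suc j))) $ n = F123 k $ n - \<dots>"
    by (simp only: right_diff_distrib fps_sub_nth mult_1_right)
  have "F123 k $ 0 = 1"
    by (simp add: F123_nth words_def occ123_def conj_commute cong: conj_cong)
  thus "(F123 k * (1 - (\<Sum>j<k. fps_const (of_nat (k choose Suc j) * cluster j)
        * fps_X ^ Suc j))) $ n = 1 $ n"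
    unfolding * using F123_recurrence[of n k] by (cases "n = 0") auto
qed

text \<open>Indexing by the number of letters: one letter gives \<open>k x\<close>, two letters have
  weight 0, and \<open>j \<ge> 3\<close> letters give \<open>U (j - 3)\<close>, the sign being
  absorbed into the power of \<open>- x\<close>.\<close>

lemma cluster_series_eq:
  assumes "k \<ge> 2"
  shows "(\<Sum>j<k. fps_const (of_nat (k choose Suc j) * cluster j) * fps_X ^ Suc j) =
    of_nat k * fps_X + (\<Sum>j=3..k. (- fps_X) ^ j * of_nat (k choose j)
                        * fps_const ((1 - Y) ^ (j div 2) * U (j - 3)))"
proof -
  obtain l where k: "k = Suc (Suc l)"
    using assms by (metis add_2_eq_Suc le_Suc_ex)
  let ?f = "\<lambda>j. fps_const (of_nat (k choose Suc j) * cluster j) * fps_X ^ Suc j"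
  have "sum ?f {..<k} = ?f 0 + ?f 1 + (\<Sum>j<l. ?f (j + 2))"
    unfolding k sum.lessThan_Suc_shift by (simp add: add.assoc)
  also have "?f 0 = of_nat k * fps_X"
    by (simp add: fps_of_nat)
  also have "?f 1 = 0"
    by simp
  also have "(\<Sum>j<l. ?f (j + 2)) = (\<Sum>j=3..k. (- fps_X) ^ j * of_nat (k choose j)
                        * fps_const ((1 - Y) ^ (j div 2) * U (j - 3)))"
  proof (rule sum.reindex_bij_witness[where i = "\<lambda>j. j - 3" and j = "\<lambda>j. j + 3"])
    fix j
    have "(- fps_X :: int poly fps) ^ (j + 3) = fps_const ((- 1) ^ (j + 3)) * fps_X ^ (j + 3)"
      by (subst power_minus) (simp flip: fps_const_power fps_const_neg)
    moreover have "Suc (j + 2) = j + 3" by simp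
    ultimately show "(- fps_X) ^ (j + 3) * of_nat (k choose (j + 3))
        * fps_const ((1 - Y) ^ ((j + 3) div 2) * U (j + 3 - 3)) = ?f (j + 2)"
      by (simp only: cluster_U fps_of_nat[symmetric] fps_const_mult[symmetric] mult_ac
          add_diff_cancel_right')
  qed (auto simp: k)
  finally show ?thesis by simp
qed

section \<open>Generating function of the polynomials \<open>U\<close>\<close>

lemma U_series:
  "Abs_fps U * (1 + fps_const (1 + Y) * fps_X ^ 2 + fps_X ^ 4) = 1 + fps_X + fps_X ^ 2"
proof (rule fps_ext)
  fix n
  \<comment> \<open>Eliminating the neighbours of the other parity leaves one recurrence with step
    2, the same for even and odd indices; it matches the denominator.\<close>
  have rec: "U (m + 4) + (1 + Y) * U (m + 2) + U m = 0" for m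
  proof -
    define s where "s = 1 - Y"
    have s: "1 + Y = 2 - s" by (simp add: s_def)
    have "m + 4 = Suc (Suc (Suc (Suc m)))" "m + 2 = Suc (Suc m)" by simp_all
    thus ?thesis
      by (cases "even m")
         (simp_all only: s U.simps s_def[symmetric] even_Suc if_True if_False simp_thms,
          simp_all add: algebra_simps)
  qed
  have "(Abs_fps U * (1 + fps_const (1 + Y) * fps_X ^ 2 + fps_X ^ 4)) $ n =
      U n + (1 + Y) * (if n < 2 then 0 else U (n - 2)) + (if n < 4 then 0 else U (n - 4))"
    by (simp only: distrib_left mult.left_commute[of "Abs_fps U" "fps_const _"] fps_add_nth
        fps_mult_left_const_nth fps_X_power_mult_right_nth mult_1_right fps_nth_Abs_fps)
  also have "\<dots> = (1 + fps_X + fps_X ^ 2) $ n"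
  proof (cases "n < 4")
    case True
    hence "n = 0 \<or> n = 1 \<or> n = 2 \<or> n = 3" by linarith
    thus ?thesis by (elim disjE) (simp_all add: numeral_eq_Suc fps_X_power_nth)
  next
    case False
    then obtain m where "n = m + 4" by (metis add.commute le_Suc_ex not_less)
    thus ?thesis using rec[of m] by (simp add: fps_X_power_nth add.commute)
  qed
  finally show "(Abs_fps U * (1 + fps_const (1 + Y) * fps_X ^ 2 + fps_X ^ 4)) $ n =
      (1 + fps_X + fps_X ^ 2) $ n" .
qed

section \<open>Quotients over the fraction field\<close>

lemma fps_to_fract_mult: "fps_to_fract (f * g) = fps_to_fract f * fps_to_fract g"
  by (simp add: fps_eq_iff fps_to_fract_def fps_mult_nth)

text \<open>The embedding is multiplicative and injective, so the image of \<open>g\<close> is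
  nonzero and cancels.\<close>

lemma fps_to_fract_eq_divide:
  fixes f g h :: "'a::idom fps"
  assumes "f * g = h" "g \<noteq> 0"
  shows "fps_to_fract f = fps_to_fract h / fps_to_fract g"
proof -
  have "fps_to_fract (0 :: 'a fps) = 0"
    by (simp add: fps_eq_iff fps_to_fract_def)
  hence "fps_to_fract g \<noteq> 0"
    using assms(2) by (metis fps_to_fract_eq_iff)
  thus ?thesis
    by (simp add: assms(1)[symmetric] fps_to_fract_mult)
qed

lemma fps_to_fract_1: "fps_to_fract 1 = 1"
  by (simp add: fps_eq_iff fps_to_fract_def)

theorem theorem3p3:
  shows "(\<forall>k\<ge>2. fps_to_fract (F123 k) =
            1 / fps_to_fract (1 - of_nat k * fps_X
                  - (\<Sum>j=3..k. (- fps_X) ^ j * of_nat (k choose j)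
                        * fps_const ((1 - Y) ^ (j div 2) * U (j - 3)))))
       \<and> fps_to_fract (Abs_fps U) =
            fps_to_fract (1 + fps_X + fps_X ^ 2)
              / fps_to_fract (1 + fps_const (1 + Y) * fps_X ^ 2 + fps_X ^ 4)"
proof (intro conjI allI impI)
  fix k :: nat assume k: "2 \<le> k"
  let ?D = "1 - of_nat k * fps_X - (\<Sum>j=3..k. (- fps_X) ^ j * of_nat (k choose j)
                        * fps_const ((1 - Y) ^ (j div 2) * U (j - 3)))"
  have "F123 k * ?D = 1"
    using F123_times_cluster_series[of k]
    unfolding cluster_series_eq[OF k] diff_diff_eq[symmetric] .
  moreover from this have "?D \<noteq> 0"
    by (metis mult_zero_right zero_neq_one)
  ultimately show "fps_to_fract (F123 k) = 1 / fps_to_fract ?D"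
    by (rule fps_to_fract_eq_divide[where h = 1, unfolded fps_to_fract_1])
next
  have "(1 + fps_const (1 + Y) * fps_X ^ 2 + fps_X ^ 4) $ 0 \<noteq> 0"
    by simp
  hence "1 + fps_const (1 + Y) * fps_X ^ 2 + fps_X ^ 4 \<noteq> 0"
    using fps_zero_nth by metis
  thus "fps_to_fract (Abs_fps U) = fps_to_fract (1 + fps_X + fps_X ^ 2)
      / fps_to_fract (1 + fps_const (1 + Y) * fps_X ^ 2 + fps_X ^ 4)"
    by (intro fps_to_fract_eq_divide U_series)
qed

end
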